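(* Let $\mathbb{K}$ be a field of characteristic zero and let $n$ be a positive integer. There is no finite SAGBI basis for the invariant ring $\mathcal{I}_n$ if the monomial order on $\mathbb{K}[x_{\{i,j\}}]$ is either lexicographic, or degree lexicographic, or degree reverse lexicographic with the $n-1$ smallest variables corresponding to adjacent edges.
   Context: Let $\mathbb{K}[x_{\{i,j\}}]$ be the polynomial ring in $\binom n2$ variables indexed by the pairs $\{i,j\}$, $1\le i<j\le n$. The variable $x_{\{i,j\}}$ corresponds to the edge $\{i,j\}$ of the complete graph on $\{1,\dots,n\}$; two edges are adjacent when they share a vertex. The symmetric group $\mathfrak{S}_n$ acts by $\sigma\cdot x_{\{i,j\}}=x_{\{\sigma(i),\sigma(j)\}}$, and $\mathcal{I}_n:=\mathbb{K}[x_{\{i,j\}}]^{\mathfrak{S}_n}$ is the ring of invariant polynomials. Given a monomial order, a SAGBI basis of a subalgebra $A$ of a polynomial ring is a subset $S\subseteq A$ such that the initial (leading) monomials of the elements of $S$ generate, as a $\mathbb{K}$-algebra, the initial algebra of $A$ (the $\mathbb{K}$-span of the initial monomials of all nonzero elements of $A$).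
   Formalization: Stated for n ≥ 4 instead of all positive n: for n = 1, 2, 3 the claim fails, since the invariant ring is K, K[x], or the symmetric polynomials in three variables, each of which has a finite SAGBI basis. *)

theory Defs
  imports Complex_Main "HOL-Library.Poly_Mapping" "HOL-Combinatorics.Permutations"
begin

text \<open>
  An exponent vector maps the variable \<open>x\<^bsub>e\<^esub>\<close>, indexed by \<open>e\<close>, to its exponent.  Polynomials are
  finitely supported families of coefficients indexed by exponent vectors; the addition of exponent
  vectors makes the product of the ring \<open>_ \<Rightarrow>\<^sub>0 _\<close> the usual product of polynomials.
\<close>

type_synonym monom = "nat set \<Rightarrow>\<^sub>0 nat"
type_synonym 'k graph_poly = "monom \<Rightarrow>\<^sub>0 'k"

definition edges :: "nat \<Rightarrow> nat set set" where
  "edges n = {{i, j} | i j. 1 \<le> i \<and> i < j \<and> j \<le> n}"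

definition adjacent :: "nat set \<Rightarrow> nat set \<Rightarrow> bool" where
  "adjacent e f \<longleftrightarrow> e \<inter> f \<noteq> {}"

definition edge_polys :: "nat \<Rightarrow> 'k::field graph_poly set" where
  "edge_polys n = {p. \<forall>m \<in> Poly_Mapping.keys p. Poly_Mapping.keys m \<subseteq> edges n}"

text \<open>
  The algebra automorphism determined by \<open>x\<^bsub>e\<^esub> \<mapsto> x\<^bsub>\<sigma>(e)\<^esub>\<close>, on exponent vectors and then, linearly, on
  polynomials.
\<close>

definition act_monom :: "(nat \<Rightarrow> nat) \<Rightarrow> monom \<Rightarrow> monom" where
  "act_monom \<sigma> m =
     (\<Sum>e\<in>Poly_Mapping.keys m. Poly_Mapping.single (\<sigma> ` e) (Poly_Mapping.lookup m e))"

definition act_poly :: "(nat \<Rightarrow> nat) \<Rightarrow> 'k::field graph_poly \<Rightarrow> 'k graph_poly" where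
  "act_poly \<sigma> p =
     (\<Sum>m\<in>Poly_Mapping.keys p. Poly_Mapping.single (act_monom \<sigma> m) (Poly_Mapping.lookup p m))"

definition graph_invariants :: "nat \<Rightarrow> 'k::field graph_poly set" where
  "graph_invariants n = {p \<in> edge_polys n. \<forall>\<sigma>. \<sigma> permutes {1..n} \<longrightarrow> act_poly \<sigma> p = p}"

text \<open>
  The strict monomial orders for an enumeration \<open>vs\<close> of the variables, listed from the largest to
  the smallest.  In the reverse lexicographic comparison the smallest variable with different
  exponents decides, and the larger exponent there gives the smaller monomial.
\<close>

definition monom_deg :: "monom \<Rightarrow> nat" where
  "monom_deg m = (\<Sum>e\<in>Poly_Mapping.keys m. Poly_Mapping.lookup m e)"

definition lex_less :: "nat set list \<Rightarrow> monom \<Rightarrow> monom \<Rightarrow> bool" where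
  "lex_less vs s t \<longleftrightarrow>
     (map (Poly_Mapping.lookup s) vs, map (Poly_Mapping.lookup t) vs) \<in> lex less_than"

definition deglex_less :: "nat set list \<Rightarrow> monom \<Rightarrow> monom \<Rightarrow> bool" where
  "deglex_less vs s t \<longleftrightarrow>
     monom_deg s < monom_deg t \<or> monom_deg s = monom_deg t \<and> lex_less vs s t"

definition degrevlex_less :: "nat set list \<Rightarrow> monom \<Rightarrow> monom \<Rightarrow> bool" where
  "degrevlex_less vs s t \<longleftrightarrow>
     monom_deg s < monom_deg t \<or> monom_deg s = monom_deg t \<and> lex_less (rev vs) t s"

definition lead_exponent :: "(monom \<Rightarrow> monom \<Rightarrow> bool) \<Rightarrow> 'k::field graph_poly \<Rightarrow> monom" where
  "lead_exponent mless p = (THE m. m \<in> Poly_Mapping.keys p \<and>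
     (\<forall>m' \<in> Poly_Mapping.keys p. m' \<noteq> m \<longrightarrow> mless m' m))"

definition initial_monomials ::
    "(monom \<Rightarrow> monom \<Rightarrow> bool) \<Rightarrow> 'k::field graph_poly set \<Rightarrow> 'k graph_poly set" where
  "initial_monomials mless A =
     {Poly_Mapping.single (lead_exponent mless p) 1 | p. p \<in> A \<and> p \<noteq> 0}"

text \<open>Here and below, \<open>single 0 c\<close> is the constant polynomial \<open>c\<close>.\<close>

interpretation poly_space: vector_space
  "\<lambda>(c::'k::field) (p::'k graph_poly). Poly_Mapping.single 0 c * p"
  by unfold_locales
    (simp_all add: algebra_simps single_add mult_single flip: mult.assoc)

inductive_set generated_algebra :: "'k::field graph_poly set \<Rightarrow> 'k graph_poly set"
  for B :: "'k graph_poly set" where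
  const: "Poly_Mapping.single 0 c \<in> generated_algebra B"
| gen: "p \<in> B \<Longrightarrow> p \<in> generated_algebra B"
| add: "p \<in> generated_algebra B \<Longrightarrow> q \<in> generated_algebra B \<Longrightarrow> p + q \<in> generated_algebra B"
| mult: "p \<in> generated_algebra B \<Longrightarrow> q \<in> generated_algebra B \<Longrightarrow> p * q \<in> generated_algebra B"

definition initial_algebra ::
    "(monom \<Rightarrow> monom \<Rightarrow> bool) \<Rightarrow> 'k::field graph_poly set \<Rightarrow> 'k graph_poly set" where
  "initial_algebra mless A = poly_space.span (initial_monomials mless A)"

definition sagbi_basis ::
    "(monom \<Rightarrow> monom \<Rightarrow> bool) \<Rightarrow> 'k::field graph_poly set \<Rightarrow> 'k graph_poly set \<Rightarrow> bool" where
  "sagbi_basis mless A S \<longleftrightarrow>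
     S \<subseteq> A \<and> generated_algebra (initial_monomials mless S) = initial_algebra mless A"

end

theory Submission
  imports Defs "HOL-Library.Multiset"
begin

text \<open>
  The leading exponents of the invariants are the exponent vectors that are maximal in their orbit.
  If a finite SAGBI basis exists, they form a finitely generated monoid, so by Dickson's lemma every
  sequence \<open>m\<close> of such vectors has indices \<open>i < j\<close> for which \<open>m\<^sub>j - m\<^sub>i\<close> is again maximal in its orbit.
  This is violated as follows.  Let \<open>e\<close> be the variable that is compared first.  Among the paths with
  three edges that have \<open>e\<close> as their middle edge choose the largest, do the same for those that have
  \<open>e\<close> as an end edge, and let \<open>H\<close> be the smaller of these two paths.  Then \<open>H\<close> is maximal for the
  stabiliser of \<open>e\<close>, but not in its full orbit.  For the lexicographic orders \<open>x\<^sub>e \<cdot> (\<Prod>h\<in>H. x\<^sub>h)\<^sup>k\<close> is maximal in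
  its orbit for all \<open>k\<close>, as the extra factor \<open>x\<^sub>e\<close> breaks the ties outside the stabiliser.  Quotients
  of such monomials are powers of \<open>\<Prod>h\<in>H. x\<^sub>h\<close>, which are not maximal.  For the reverse lexicographic
  order one divides a power of the product of all variables by these monomials.
\<close>

section \<open>Finite generation\<close>

lemma nat_seq_mono_subseq:
  fixes s :: "nat \<Rightarrow> nat"
  shows "\<exists>r :: nat \<Rightarrow> nat. strict_mono r \<and> mono (s \<circ> r)"
proof -
  obtain r :: "nat \<Rightarrow> nat" where r: "strict_mono r" "monoseq (\<lambda>n. s (r n))"
    using seq_monosub[of s] by auto
  show ?thesis
  proof (cases "mono (s \<circ> r)")
    case False
    then have dec: "\<And>i j. i \<le> j \<Longrightarrow> s (r j) \<le> s (r i)"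
      using r(2) unfolding monoseq_def mono_def by auto
    \<comment> \<open>A decreasing subsequence attains its least value \<open>v\<close> and is
      constant from then on, so its tail is monotone.\<close>
    define v where "v = (LEAST v. \<exists>k. s (r k) = v)"
    have "\<exists>k. s (r k) = v"
      unfolding v_def by (rule LeastI_ex) auto
    then obtain k where k: "s (r k) = v" by blast
    have "s (r (k + n)) = v" for n
    proof (rule antisym)
      show "s (r (k + n)) \<le> v" using dec[of k "k + n"] k by simp
      show "v \<le> s (r (k + n))" unfolding v_def by (rule Least_le) auto
    qed
    then have "mono (s \<circ> (\<lambda>n. r (k + n)))" by (simp add: mono_def)
    moreover have "strict_mono (\<lambda>n. r (k + n))"
      using r(1) by (simp add: strict_mono_def)
    ultimately show ?thesis by (auto simp: comp_def intro!: exI[of _ "\<lambda>n. r (k + n)"])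
  qed (use r in blast)
qed

text \<open>Coordinates are treated one at a time: thinning the subsequence further for
  \<open>x\<close> keeps the coordinates already settled monotone.\<close>

lemma dickson_subseq:
  fixes f :: "nat \<Rightarrow> 'a \<Rightarrow> nat"
  assumes "finite L"
  shows "\<exists>r :: nat \<Rightarrow> nat. strict_mono r \<and> (\<forall>l\<in>L. mono (\<lambda>k. f (r k) l))"
  using assms
proof induction
  case empty
  show ?case by (rule exI[of _ id]) (simp add: strict_mono_def)
next
  case (insert x L)
  then obtain r :: "nat \<Rightarrow> nat" where r: "strict_mono r" "\<forall>l\<in>L. mono (\<lambda>k. f (r k) l)" by blast
  obtain q :: "nat \<Rightarrow> nat" where q: "strict_mono q" "mono ((\<lambda>k. f (r k) x) \<circ> q)"
    using nat_seq_mono_subseq by blast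
  have "strict_mono (r \<circ> q)" using r(1) q(1) by (simp add: strict_mono_def)
  moreover have "\<forall>l\<in>insert x L. mono (\<lambda>k. f ((r \<circ> q) k) l)"
    using r(2) q by (auto simp: mono_def strict_mono_less_eq)
  ultimately show ?case by blast
qed

text \<open>Multiplicities of generators are compared here rather than exponents, so that the
  difference of the two multisets is again a product of generators.\<close>

lemma dickson_multiset:
  fixes A :: "nat \<Rightarrow> 'a multiset"
  assumes "finite L" and "\<And>k. set_mset (A k) \<subseteq> L"
  shows "\<exists>i j. i < j \<and> A i \<subseteq># A j"
proof -
  obtain r :: "nat \<Rightarrow> nat" where r: "strict_mono r" "\<forall>l\<in>L. mono (\<lambda>k. count (A (r k)) l)"
    using dickson_subseq[OF assms(1), of "\<lambda>k. count (A k)"] by blast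
  have "count (A (r 0)) l \<le> count (A (r 1)) l" for l
  proof (cases "l \<in> L")
    case True
    then show ?thesis using r(2) by (simp add: mono_def)
  next
    case False
    then have "l \<notin># A (r 0)" using assms(2) by blast
    then show ?thesis by (simp add: not_in_iff)
  qed
  then have "A (r 0) \<subseteq># A (r 1)" by (simp add: subseteq_mset_def)
  moreover have "r 0 < r 1" using r(1) by (simp add: strict_mono_def)
  ultimately show ?thesis by blast
qed

section \<open>Algebras and spans generated by monomials\<close>

definition lead_exponents :: "(monom \<Rightarrow> monom \<Rightarrow> bool) \<Rightarrow> 'k::field graph_poly set \<Rightarrow> monom set" where
  "lead_exponents mless A = {lead_exponent mless p | p. p \<in> A \<and> p \<noteq> 0}"

lemma initial_monomials_eq:
  "initial_monomials mless A = (\<lambda>t. Poly_Mapping.single t 1) ` lead_exponents mless A"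
  by (auto simp: initial_monomials_def lead_exponents_def)

text \<open>A multiset \<open>D\<close> over \<open>L\<close> encodes a product of generators, with
  \<open>{#}\<close> for the constants. The exponents of such products are closed under
  addition.\<close>

lemma keys_generated_algebra:
  assumes "p \<in> generated_algebra ((\<lambda>t. Poly_Mapping.single t (1::'k::field)) ` L)"
    and "m \<in> Poly_Mapping.keys p"
  shows "\<exists>D. set_mset D \<subseteq> L \<and> m = sum_mset D"
  using assms
proof (induction arbitrary: m)
  case (const c)
  then have "m = sum_mset {#}" by (auto split: if_splits)
  then show ?case by (intro exI[of _ "{#}"]) simp
next
  case (gen p)
  then obtain t where "t \<in> L" "m = t" by (auto split: if_splits)
  then show ?case by (intro exI[of _ "{#t#}"]) simp
next
  case (add p q)
  then show ?case using keys_add[of p q] by blast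
next
  case (mult p q)
  then obtain a b where ab: "a \<in> Poly_Mapping.keys p" "b \<in> Poly_Mapping.keys q" "m = a + b"
    using keys_mult[of p q] by blast
  obtain D where D: "set_mset D \<subseteq> L" "a = sum_mset D" using mult.IH(1) ab(1) by blast
  obtain D' where D': "set_mset D' \<subseteq> L" "b = sum_mset D'" using mult.IH(2) ab(2) by blast
  show ?case using D D' ab(3) by (intro exI[of _ "D + D'"]) simp
qed

lemma sum_mset_in_generated_algebra:
  assumes "set_mset D \<subseteq> L"
  shows "Poly_Mapping.single (sum_mset D) 1
    \<in> generated_algebra ((\<lambda>t. Poly_Mapping.single t (1::'k::field)) ` L)"
  using assms
proof (induction D)
  case empty
  show ?case using generated_algebra.const[of 1] by simp
next
  case (add t D)
  then have "Poly_Mapping.single t (1::'k) * Poly_Mapping.single (sum_mset D) 1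
      \<in> generated_algebra ((\<lambda>t. Poly_Mapping.single t 1) ` L)"
    by (intro generated_algebra.mult) (auto intro: generated_algebra.gen)
  then show ?case by (simp add: mult_single)
qed

lemma keys_span_monomials:
  assumes "p \<in> poly_space.span ((\<lambda>t. Poly_Mapping.single t (1::'k::field)) ` L)"
  shows "Poly_Mapping.keys p \<subseteq> L"
proof -
  have "poly_space.subspace {p :: 'k graph_poly. Poly_Mapping.keys p \<subseteq> L}"
  proof (rule poly_space.subspaceI)
    fix c :: 'k and x :: "'k graph_poly"
    assume x: "x \<in> {p. Poly_Mapping.keys p \<subseteq> L}"
    have "Poly_Mapping.keys (Poly_Mapping.single 0 c * x)
        \<subseteq> {a + b |a b. a \<in> Poly_Mapping.keys (Poly_Mapping.single (0::monom) c) \<and> b \<in> Poly_Mapping.keys x}"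
      by (rule keys_mult)
    also have "\<dots> \<subseteq> Poly_Mapping.keys x" by (auto split: if_splits)
    finally show "Poly_Mapping.single 0 c * x \<in> {p. Poly_Mapping.keys p \<subseteq> L}" using x by auto
  next
    fix x y :: "'k graph_poly"
    assume "x \<in> {p. Poly_Mapping.keys p \<subseteq> L}" "y \<in> {p. Poly_Mapping.keys p \<subseteq> L}"
    then show "x + y \<in> {p. Poly_Mapping.keys p \<subseteq> L}" using keys_add[of x y] by blast
  qed simp
  then have "poly_space.span ((\<lambda>t. Poly_Mapping.single t (1::'k)) ` L) \<subseteq> {p. Poly_Mapping.keys p \<subseteq> L}"
    by (intro poly_space.span_minimal) auto
  then show ?thesis using assms by blast
qed

text \<open>Each \<open>m k\<close> factors into the finitely many initial monomials of
  \<open>S\<close>. By Dickson's lemma one factorisation contains an earlier one, and the remaining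
  factors multiply to the monomial with exponent \<open>d\<close>.\<close>

lemma sagbi_basis_finite_imp_lead_exponent_difference:
  assumes "finite S" and "sagbi_basis mless A S"
    and "\<And>k::nat. m k \<in> lead_exponents mless A"
  shows "\<exists>i j d. i < j \<and> m j = m i + d \<and> d \<in> lead_exponents mless A"
proof -
  let ?T = "\<lambda>t::monom. Poly_Mapping.single t (1::'a)"
  define L where "L = lead_exponents mless S"
  have eq: "generated_algebra (?T ` L) = poly_space.span (?T ` lead_exponents mless A)"
    using assms(2) by (simp add: sagbi_basis_def initial_algebra_def initial_monomials_eq L_def)
  have "finite L"
    using assms(1) by (simp add: L_def lead_exponents_def)
  have "\<exists>D. set_mset D \<subseteq> L \<and> m k = sum_mset D" for k
  proof (rule keys_generated_algebra)
    show "?T (m k) \<in> generated_algebra (?T ` L)"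
      unfolding eq using assms(3) by (intro poly_space.span_base) blast
  qed simp
  then obtain D where D: "\<And>k. set_mset (D k) \<subseteq> L" "\<And>k. m k = sum_mset (D k)"
    by metis
  obtain i j where ij: "i < j" "D i \<subseteq># D j"
    using dickson_multiset[OF \<open>finite L\<close> D(1)] by blast
  define d where "d = sum_mset (D j - D i)"
  have "m j = m i + d"
    unfolding D(2) d_def using ij(2) by (metis subset_mset.add_diff_inverse sum_mset.union)
  moreover have "?T d \<in> generated_algebra (?T ` L)"
    unfolding d_def using D(1)[of j] by (intro sum_mset_in_generated_algebra) (meson in_diffD subset_iff)
  \<comment> \<open>The initial algebra is spanned by initial monomials, so every monomial in it is
    one of them.\<close>
  then have "d \<in> lead_exponents mless A"
    unfolding eq using keys_span_monomials by fastforce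
  ultimately show ?thesis using ij(1) by blast
qed

section \<open>Leading exponents of invariants\<close>

lemma lookup_act_monom:
  assumes "bij \<sigma>"
  shows "Poly_Mapping.lookup (act_monom \<sigma> m) e = Poly_Mapping.lookup m (inv \<sigma> ` e)"
proof -
  have *: "\<sigma> ` f = e \<longleftrightarrow> f = inv \<sigma> ` e" for f
    using assms by (metis bij_is_inj bij_is_surj image_f_inv_f image_inv_f_f)
  have "Poly_Mapping.lookup (act_monom \<sigma> m) e
      = (\<Sum>f\<in>Poly_Mapping.keys m. if f = inv \<sigma> ` e then Poly_Mapping.lookup m f else 0)"
    by (simp add: act_monom_def lookup_sum lookup_single when_def *)
  also have "\<dots> = Poly_Mapping.lookup m (inv \<sigma> ` e)"
    by (simp add: in_keys_iff)
  finally show ?thesis .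
qed

lemma act_monom_id: "act_monom id m = m"
  by (rule poly_mapping_eqI) (simp add: lookup_act_monom)

lemma act_monom_comp:
  assumes "bij \<sigma>" "bij \<rho>"
  shows "act_monom \<sigma> (act_monom \<rho> m) = act_monom (\<sigma> \<circ> \<rho>) m"
  using assms
  by (intro poly_mapping_eqI) (simp add: lookup_act_monom bij_comp o_inv_distrib image_comp)

lemma inj_act_monom:
  assumes "bij \<sigma>"
  shows "inj (act_monom \<sigma>)"
proof (rule inj_on_inverseI)
  show "act_monom (inv \<sigma>) (act_monom \<sigma> m) = m" for m
    using assms by (simp add: act_monom_comp bij_imp_bij_inv bij_is_inj act_monom_id)
qed

lemma keys_act_monom:
  assumes "bij \<sigma>"
  shows "Poly_Mapping.keys (act_monom \<sigma> m) = (`) \<sigma> ` Poly_Mapping.keys m"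
proof -
  have "e \<in> (`) \<sigma> ` Poly_Mapping.keys m" if "inv \<sigma> ` e \<in> Poly_Mapping.keys m" for e
    using that assms by (metis bij_is_surj image_eqI image_f_inv_f)
  then show ?thesis
    using assms by (auto simp: in_keys_iff lookup_act_monom bij_is_inj image_inv_f_f)
qed

lemma monom_deg_act_monom:
  assumes "bij \<sigma>"
  shows "monom_deg (act_monom \<sigma> m) = monom_deg m"
proof -
  have "inj ((`) \<sigma>)" using assms by (intro injI) (simp add: bij_is_inj inj_image_eq_iff)
  then show ?thesis
    using assms unfolding monom_deg_def keys_act_monom[OF assms]
    by (subst sum.reindex) (auto simp: lookup_act_monom bij_is_inj image_inv_f_f intro: inj_on_subset)
qed

text \<open>Since \<open>act_monom \<sigma>\<close> is injective, no two terms of \<open>p\<close>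
  are merged.\<close>

lemma lookup_act_poly:
  assumes "bij \<sigma>"
  shows "Poly_Mapping.lookup (act_poly \<sigma> p) (act_monom \<sigma> m) = Poly_Mapping.lookup p m"
  using inj_act_monom[OF assms]
  by (simp add: act_poly_def lookup_sum lookup_single when_def inj_eq in_keys_iff)

lemma edges_memI:
  assumes "i \<in> {1..n}" "j \<in> {1..n}" "i \<noteq> j"
  shows "{i, j} \<in> edges n"
proof (cases "i < j")
  case True
  then show ?thesis using assms by (auto simp: edges_def)
next
  case False
  then have "{i, j} = {j, i} \<and> 1 \<le> j \<and> j < i \<and> i \<le> n" using assms by auto
  then show ?thesis unfolding edges_def by blast
qed

lemma image_in_edges:
  assumes "\<sigma> permutes {1..n}" "e \<in> edges n"
  shows "\<sigma> ` e \<in> edges n"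
proof -
  obtain i j where e: "e = {i, j}" "i \<in> {1..n}" "j \<in> {1..n}" "i \<noteq> j"
    using assms(2) by (fastforce simp: edges_def)
  have "\<sigma> i \<in> {1..n}" "\<sigma> j \<in> {1..n}" "\<sigma> i \<noteq> \<sigma> j"
    using e permutes_in_image[OF assms(1)] permutes_inj[OF assms(1)] by (auto simp: inj_eq)
  then show ?thesis
    unfolding e(1) using edges_memI[of "\<sigma> i" n "\<sigma> j"] by simp
qed

text \<open>Linearity is relative to \<open>X\<close> because \<open>lex_less vs\<close> cannot tell
  apart vectors that differ only outside \<open>vs\<close>.\<close>

definition strict_linear_on :: "'a set \<Rightarrow> ('a \<Rightarrow> 'a \<Rightarrow> bool) \<Rightarrow> bool" where
  "strict_linear_on X R \<longleftrightarrow> asymp_on X R \<and> transp_on X R \<and> totalp_on X R"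

definition orbit_maximal :: "nat \<Rightarrow> (monom \<Rightarrow> monom \<Rightarrow> bool) \<Rightarrow> monom set" where
  "orbit_maximal n mless = {m. Poly_Mapping.keys m \<subseteq> edges n \<and>
     (\<forall>\<sigma>. \<sigma> permutes {1..n} \<longrightarrow> \<not> mless m (act_monom \<sigma> m))}"

lemma lead_exponent_eqI:
  assumes "strict_linear_on X mless" and "Poly_Mapping.keys p \<subseteq> X"
    and "m \<in> Poly_Mapping.keys p"
    and "\<And>t. t \<in> Poly_Mapping.keys p \<Longrightarrow> \<not> mless m t"
  shows "lead_exponent mless p = m"
  unfolding lead_exponent_def
proof (rule the_equality)
  show "m \<in> Poly_Mapping.keys p \<and> (\<forall>t\<in>Poly_Mapping.keys p. t \<noteq> m \<longrightarrow> mless t m)"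
    using assms by (auto simp: strict_linear_on_def totalp_on_def)
qed (metis assms(3,4))

lemma lead_exponent_in_keys:
  assumes "strict_linear_on X mless" and "Poly_Mapping.keys p \<subseteq> X" and "p \<noteq> 0"
  shows "lead_exponent mless p \<in> Poly_Mapping.keys p \<and>
    (\<forall>t \<in> Poly_Mapping.keys p. \<not> mless (lead_exponent mless p) t)"
proof -
  have a: "asymp_on (Poly_Mapping.keys p) mless"
    and t: "transp_on (Poly_Mapping.keys p) mless"
    using assms(1,2) by (auto simp: strict_linear_on_def intro: asymp_on_subset transp_on_subset)
  obtain m where m: "m \<in> Poly_Mapping.keys p"
      "\<forall>t\<in>Poly_Mapping.keys p. t \<noteq> m \<longrightarrow> \<not> mless m t"
    using Finite_Set.bex_max_element[OF finite_keys a t] assms(3) by auto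
  then have "\<not> mless m t" if "t \<in> Poly_Mapping.keys p" for t
    using that m asymp_onD[OF a] by metis
  then show ?thesis using m lead_exponent_eqI[OF assms(1,2)] by metis
qed

text \<open>The support of an invariant is a union of orbits, so its leading exponent is maximal in
  its orbit. Conversely, a maximal \<open>m\<close> leads the sum of its orbit.\<close>

lemma lead_exponents_graph_invariants:
  assumes "strict_linear_on {m. Poly_Mapping.keys m \<subseteq> edges n} mless"
  shows "lead_exponents mless (graph_invariants n :: 'k::field graph_poly set)
    = orbit_maximal n mless"
proof (intro equalityI subsetI)
  fix m assume "m \<in> lead_exponents mless (graph_invariants n :: 'k graph_poly set)"
  then obtain p :: "'k graph_poly"
    where p: "p \<in> graph_invariants n" "p \<noteq> 0" "m = lead_exponent mless p"
    by (auto simp: lead_exponents_def)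
  have "Poly_Mapping.keys p \<subseteq> {m. Poly_Mapping.keys m \<subseteq> edges n}"
    using p(1) by (auto simp: graph_invariants_def edge_polys_def)
  note sub = this and lead = lead_exponent_in_keys[OF assms this p(2)]
  have "\<not> mless m (act_monom \<sigma> m)" if "\<sigma> permutes {1..n}" for \<sigma>
  proof -
    have "act_poly \<sigma> p = p" using p(1) that by (simp add: graph_invariants_def)
    then have "act_monom \<sigma> m \<in> Poly_Mapping.keys p"
      using lookup_act_poly[OF permutes_bij[OF that], of p m] lead p(3) by (simp add: in_keys_iff)
    then show ?thesis using lead p(3) by blast
  qed
  then show "m \<in> orbit_maximal n mless"
    using lead sub p(3) by (auto simp: orbit_maximal_def)
next
  fix m assume m: "m \<in> orbit_maximal n mless"
  \<comment> \<open>The orbit is taken as a set, so the coefficients of its sum are 1 in every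
    characteristic.\<close>
  define orb where "orb = (\<lambda>\<sigma>. act_monom \<sigma> m) ` {\<sigma>. \<sigma> permutes {1..n}}"
  have "finite orb" by (simp add: orb_def finite_permutations)
  define p :: "'k graph_poly" where "p = (\<Sum>t\<in>orb. Poly_Mapping.single t 1)"
  have lookup_p: "Poly_Mapping.lookup p t = (if t \<in> orb then 1 else 0)" for t
    using \<open>finite orb\<close> by (simp add: p_def lookup_sum lookup_single when_def)
  have keys_p: "Poly_Mapping.keys p = orb"
    by (auto simp: in_keys_iff lookup_p split: if_splits)
  have sub: "orb \<subseteq> {m. Poly_Mapping.keys m \<subseteq> edges n}"
    using m by (auto simp: orb_def orbit_maximal_def keys_act_monom permutes_bij image_in_edges subset_iff
        simp del: One_nat_def)
  have "m \<in> orb" unfolding orb_def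
    by (rule image_eqI[of _ _ id]) (simp_all add: act_monom_id permutes_id)
  have "act_poly \<sigma> p = p" if \<sigma>: "\<sigma> permutes {1..n}" for \<sigma>
  proof -
    have b: "bij \<sigma>" using \<sigma> by (rule permutes_bij)
    have "act_monom \<sigma> ` orb \<subseteq> orb"
      unfolding orb_def using \<sigma>
      by (auto simp: act_monom_comp permutes_bij intro!: image_eqI permutes_compose)
    then have eq: "act_monom \<sigma> ` orb = orb"
      using \<open>finite orb\<close> inj_act_monom[OF b] by (intro endo_inj_surj) (auto intro: inj_on_subset)
    have "act_poly \<sigma> p = (\<Sum>t\<in>orb. Poly_Mapping.single (act_monom \<sigma> t) 1)"
      by (simp add: act_poly_def keys_p lookup_p)
    also have "\<dots> = (\<Sum>t\<in>act_monom \<sigma> ` orb. Poly_Mapping.single t 1)"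
      using inj_act_monom[OF b] by (subst sum.reindex) (auto intro: inj_on_subset)
    finally show ?thesis by (simp add: eq p_def)
  qed
  then have "p \<in> graph_invariants n"
    using sub by (auto simp: graph_invariants_def edge_polys_def keys_p)
  moreover have "p \<noteq> 0" using keys_p \<open>m \<in> orb\<close> by auto
  moreover have "lead_exponent mless p = m"
    using m sub \<open>m \<in> orb\<close> by (intro lead_exponent_eqI[OF assms]) (auto simp: keys_p orb_def orbit_maximal_def)
  ultimately show "m \<in> lead_exponents mless (graph_invariants n :: 'k graph_poly set)"
    by (auto simp: lead_exponents_def)
qed

section \<open>Lexicographic comparison of functions\<close>

text \<open>The parameter \<open>R\<close> will be \<open><\<close> on exponents, its converse for
  the reverse lexicographic order, and \<open><\<close> on truth values for indicators of edge
  sets.\<close>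

primrec lex_by :: "('b \<Rightarrow> 'b \<Rightarrow> bool) \<Rightarrow> 'a list \<Rightarrow> ('a \<Rightarrow> 'b) \<Rightarrow> ('a \<Rightarrow> 'b) \<Rightarrow> bool" where
  "lex_by R [] f g \<longleftrightarrow> False"
| "lex_by R (v # vs) f g \<longleftrightarrow> R (f v) (g v) \<or> f v = g v \<and> lex_by R vs f g"

text \<open>Only the outcomes of the single comparisons matter, so indicators and exponent vectors
  built from them can be exchanged.\<close>

lemma lex_by_cong:
  assumes "\<And>v. v \<in> set vs \<Longrightarrow> R (f v) (g v) = R' (f' v) (g' v)"
    and "\<And>v. v \<in> set vs \<Longrightarrow> f v = g v \<longleftrightarrow> f' v = g' v"
  shows "lex_by R vs f g \<longleftrightarrow> lex_by R' vs f' g'"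
  using assms by (induction vs) auto

lemma lex_by_flip: "lex_by (\<lambda>x y. R y x) vs f g \<longleftrightarrow> lex_by R vs g f"
  by (induction vs) auto

lemma lex_less_eq_lex_by:
  "lex_less vs s t \<longleftrightarrow> lex_by (<) vs (Poly_Mapping.lookup s) (Poly_Mapping.lookup t)"
  unfolding lex_less_def by (induction vs) auto

lemma lex_by_less_asym:
  fixes f :: "'a \<Rightarrow> 'b::linorder"
  shows "lex_by (<) vs f g \<Longrightarrow> \<not> lex_by (<) vs g f"
  by (induction vs) auto

lemma lex_by_less_trans:
  fixes f :: "'a \<Rightarrow> 'b::linorder"
  shows "lex_by (<) vs f g \<Longrightarrow> lex_by (<) vs g h \<Longrightarrow> lex_by (<) vs f h"
  by (induction vs) auto

lemma lex_by_less_total: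
  fixes f :: "'a \<Rightarrow> 'b::linorder"
  shows "lex_by (<) vs f g \<or> lex_by (<) vs g f \<or> (\<forall>v\<in>set vs. f v = g v)"
  by (induction vs) auto

lemma strict_linear_lex_less:
  "strict_linear_on {m. Poly_Mapping.keys m \<subseteq> set vs} (lex_less vs)"
proof -
  have "s = t" if "Poly_Mapping.keys s \<subseteq> set vs" "Poly_Mapping.keys t \<subseteq> set vs"
    "\<forall>v\<in>set vs. Poly_Mapping.lookup s v = Poly_Mapping.lookup t v" for s t :: monom
    using that by (metis in_keys_iff poly_mapping_eqI subsetD)
  then show ?thesis
    unfolding strict_linear_on_def asymp_on_def transp_on_def totalp_on_def lex_less_eq_lex_by
    using lex_by_less_asym lex_by_less_trans lex_by_less_total
    by (smt (verit) mem_Collect_eq)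
qed

lemma strict_linear_on_flip:
  "strict_linear_on X R \<Longrightarrow> strict_linear_on X (\<lambda>x y. R y x)"
  unfolding strict_linear_on_def asymp_on_def transp_on_def totalp_on_def by blast

lemma strict_linear_on_refine:
  fixes d :: "'a \<Rightarrow> nat"
  assumes "strict_linear_on X R"
  shows "strict_linear_on X (\<lambda>x y. d x < d y \<or> d x = d y \<and> R x y)"
  using assms unfolding strict_linear_on_def asymp_on_def transp_on_def totalp_on_def
  by (smt (verit) less_trans linorder_neqE_nat order_less_asym)

section \<open>A path that is maximal for the stabiliser of an edge only\<close>

lemma permutes_two_points:
  assumes "i \<in> A" "j \<in> A" "i \<noteq> j" "a \<in> A" "b \<in> A" "a \<noteq> b"
  shows "\<exists>\<tau>. \<tau> permutes A \<and> \<tau> ` {i, j} = {a, b}"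
proof -
  let ?j = "Transposition.transpose i a j"
  have "?j \<in> A" "?j \<noteq> a" using assms by (auto simp: Transposition.transpose_def)
  \<comment> \<open>The second transposition fixes \<open>a\<close>, as neither \<open>?j\<close>
    nor \<open>b\<close> equals \<open>a\<close>.\<close>
  then have "Transposition.transpose ?j b \<circ> Transposition.transpose i a permutes A"
    using assms by (intro permutes_compose permutes_swap_id) auto
  moreover have "(Transposition.transpose ?j b \<circ> Transposition.transpose i a) ` {i, j} = {a, b}"
    using assms \<open>?j \<noteq> a\<close> by (auto simp: Transposition.transpose_def)
  ultimately show ?thesis by blast
qed

text \<open>The edges of \<open>H\<close> other than \<open>{1, 2}\<close> share the vertex 3. The
  preimages of the two end edges would both be among them, although the end edges are
  disjoint.\<close>

lemma path_end_not_middle: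
  fixes \<tau> :: "nat \<Rightarrow> nat"
  defines "H \<equiv> {{1, 2}, {2, 3}, {3, 4}}"
  assumes "bij \<tau>" and "\<tau> ` {1, 2} = {2, 3}"
    and H: "\<And>e. e \<in> {{1, 2}, {3, 4}} \<Longrightarrow> inv \<tau> ` e \<in> H"
  shows False
proof -
  define f g where "f = inv \<tau> ` {1, 2}" and "g = inv \<tau> ` {3, 4}"
  have \<tau>f: "\<tau> ` f = {1, 2}" and \<tau>g: "\<tau> ` g = {3, 4}"
    unfolding f_def g_def using assms(2) by (simp_all only: image_f_inv_f bij_is_surj)
  have fg: "f \<in> H" "g \<in> H" unfolding f_def g_def by (rule H; simp)+
  have "\<tau> ` f \<noteq> {2, 3}" "\<tau> ` g \<noteq> {2, 3}"
    unfolding \<tau>f \<tau>g by (simp_all add: doubleton_eq_iff del: image_insert)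
  then have "f \<noteq> {1, 2}" "g \<noteq> {1, 2}" using assms(3) by metis+
  then have "3 \<in> f" "3 \<in> g" using fg by (auto simp: H_def)
  then have "\<tau> 3 \<in> {1, 2} \<inter> {3, 4}" using \<tau>f \<tau>g by blast
  then show False by simp
qed

lemma ex_stabilizer_maximal_pattern:
  assumes "n \<ge> 4" and "set L = edges n" and "e \<in> edges n"
  shows "\<exists>\<chi> :: nat set \<Rightarrow> bool. \<chi> e
    \<and> (\<forall>\<tau>. \<tau> permutes {1..n} \<longrightarrow> \<tau> ` e = e \<longrightarrow> \<not> lex_by (<) L \<chi> (\<lambda>f. \<chi> (\<tau> ` f)))
    \<and> (\<exists>\<tau>. \<tau> permutes {1..n} \<and> lex_by (<) L \<chi> (\<lambda>f. \<chi> (\<tau> ` f)))"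
proof -
  \<comment> \<open>\<open>H\<close> is a fixed model path, and \<open>copies h\<close> holds the
    indicators of its relabelled copies in which \<open>e\<close> takes the place of
    \<open>h\<close>: an end edge for \<open>{1, 2}\<close>, the middle edge for
    \<open>{2, 3}\<close>.\<close>
  define H :: "nat set set" where "H = {{1, 2}, {2, 3}, {3, 4}}"
  define copies where
    "copies h = (\<lambda>\<tau> f. \<tau> ` f \<in> H) ` {\<tau>. \<tau> permutes {1..n} \<and> \<tau> ` e = h}" for h
  obtain i j where ij: "e = {i, j}" "i \<in> {1..n}" "j \<in> {1..n}" "i \<noteq> j"
    using assms(3) by (fastforce simp: edges_def)
  have copies_e: "\<chi> e" if "\<chi> \<in> copies h" "h \<in> H" for \<chi> h
    using that by (auto simp: copies_def)
  \<comment> \<open>The stabiliser of \<open>e\<close> preserves each class of copies, so a largest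
    member of a class is maximal under it.\<close>
  have stab: "(\<lambda>f. \<chi> (\<rho> ` f)) \<in> copies h"
    if \<chi>: "\<chi> \<in> copies h" and \<rho>: "\<rho> permutes {1..n}" "\<rho> ` e = e" for \<chi> h \<rho>
  proof -
    obtain \<tau> where \<tau>: "\<tau> permutes {1..n}" "\<tau> ` e = h" "\<chi> = (\<lambda>f. \<tau> ` f \<in> H)"
      using \<chi> by (auto simp: copies_def)
    have "\<tau> \<circ> \<rho> permutes {1..n}" using \<tau> \<rho> by (simp add: permutes_compose)
    moreover have "(\<tau> \<circ> \<rho>) ` e = h" using \<tau> \<rho> by (simp only: image_comp[symmetric])
    ultimately show ?thesis
      unfolding copies_def \<tau>(3) by (intro image_eqI[of _ _ "\<tau> \<circ> \<rho>"]) (auto simp: image_comp)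
  qed
  have same_orbit: "\<exists>\<rho>. \<rho> permutes {1..n} \<and> \<chi>' = (\<lambda>f. \<chi> (\<rho> ` f))"
    if \<chi>: "\<chi> \<in> copies h" and \<chi>': "\<chi>' \<in> copies h'" for \<chi> \<chi>' h h'
  proof -
    obtain \<tau> where \<tau>: "\<tau> permutes {1..n}" "\<chi> = (\<lambda>f. \<tau> ` f \<in> H)"
      using \<chi> by (auto simp: copies_def)
    obtain \<tau>' where \<tau>': "\<tau>' permutes {1..n}" "\<chi>' = (\<lambda>f. \<tau>' ` f \<in> H)"
      using \<chi>' by (auto simp: copies_def)
    have "inv \<tau> \<circ> \<tau>' permutes {1..n}" using \<tau> \<tau>' by (simp add: permutes_compose permutes_inv)
    moreover have "\<tau> ` (inv \<tau> \<circ> \<tau>') ` f = \<tau>' ` f" for f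
      using permutes_surj[OF \<tau>(1)] by (simp only: image_comp[symmetric] image_f_inv_f)
    ultimately show ?thesis unfolding \<tau>(2) \<tau>'(2) by (intro exI[of _ "inv \<tau> \<circ> \<tau>'"]) simp
  qed
  have ex_max: "\<exists>\<chi>\<in>copies h. \<forall>\<chi>'\<in>copies h. \<not> lex_by (<) L \<chi> \<chi>'"
    if "h = {a, b}" "a \<in> {1..n}" "b \<in> {1..n}" "a \<noteq> b" for h a b
  proof -
    have "copies h \<noteq> {}"
      using permutes_two_points[OF ij(2-4) that(2-4)] that(1) by (auto simp: copies_def ij(1))
    moreover have "finite (copies h)"
      unfolding copies_def
      by (intro finite_imageI finite_subset[OF _ finite_permutations[of "{1..n}"]]) auto
    moreover have "asymp_on (copies h) (lex_by (<) L)" "transp_on (copies h) (lex_by (<) L)"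
      using lex_by_less_asym lex_by_less_trans unfolding asymp_on_def transp_on_def by blast+
    ultimately show ?thesis
      using Finite_Set.bex_max_element[of "copies h" "lex_by (<) L"] lex_by_less_asym by metis
  qed
  obtain \<chi> where \<chi>: "\<chi> \<in> copies {1, 2}" "\<forall>\<chi>'\<in>copies {1, 2}. \<not> lex_by (<) L \<chi> \<chi>'"
    using ex_max[of "{1, 2}" 1 2] assms(1) by auto
  obtain \<psi> where \<psi>: "\<psi> \<in> copies {2, 3}" "\<forall>\<chi>'\<in>copies {2, 3}. \<not> lex_by (<) L \<psi> \<chi>'"
    using ex_max[of "{2, 3}" 2 3] assms(1) by auto
  have "\<not> (\<forall>f\<in>edges n. \<chi> f = \<psi> f)"
  proof
    assume eq: "\<forall>f\<in>edges n. \<chi> f = \<psi> f"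
    obtain \<tau> where \<tau>: "\<tau> permutes {1..n}" "\<tau> ` e = {1, 2}" "\<chi> = (\<lambda>f. \<tau> ` f \<in> H)"
      using \<chi>(1) by (auto simp: copies_def)
    obtain \<rho> where \<rho>: "\<rho> permutes {1..n}" "\<rho> ` e = {2, 3}" "\<psi> = (\<lambda>f. \<rho> ` f \<in> H)"
      using \<psi>(1) by (auto simp: copies_def)
    have b: "bij \<tau>" "bij \<rho>" using \<tau> \<rho> by (simp_all add: permutes_bij)
    have inv: "inv (\<rho> \<circ> inv \<tau>) = \<tau> \<circ> inv \<rho>"
      using b by (simp add: o_inv_distrib bij_imp_bij_inv inv_inv_eq)
    \<comment> \<open>If the two paths coincided, \<open>\<rho> \<circ> inv \<tau>\<close> would
      preserve \<open>H\<close> and move its end edge \<open>{1, 2}\<close> through \<open>e\<close>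
      to the middle edge \<open>{2, 3}\<close>.\<close>
    show False
    proof (rule path_end_not_middle[of "\<rho> \<circ> inv \<tau>"])
      show "bij (\<rho> \<circ> inv \<tau>)" using b by (simp add: bij_comp bij_imp_bij_inv)
      have "inv \<tau> ` {1, 2} = e" using \<tau>(2) b(1) by (metis bij_is_inj image_inv_f_f)
      then show "(\<rho> \<circ> inv \<tau>) ` {1, 2} = {2, 3}"
        using \<rho>(2) by (simp only: image_comp[symmetric])
      fix f :: "nat set" assume f: "f \<in> {{1, 2}, {3, 4}}"
      have "f \<in> edges n" using f assms(1) edges_memI[of 1 n 2] edges_memI[of 3 n 4] by auto
      then have "inv \<rho> ` f \<in> edges n" by (rule image_in_edges[OF permutes_inv[OF \<rho>(1)]])
      moreover have "\<psi> (inv \<rho> ` f)"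
        using f b(2) by (auto simp: \<rho>(3) H_def image_f_inv_f bij_is_surj simp del: image_insert)
      ultimately have "\<chi> (inv \<rho> ` f)" using eq by blast
      then show "inv (\<rho> \<circ> inv \<tau>) ` f \<in> {{1, 2}, {2, 3}, {3, 4}}"
        by (simp add: \<tau>(3) inv image_comp H_def)
    qed
  qed
  \<comment> \<open>The smaller pattern is the witness: the other one lies in the same orbit and
    exceeds it.\<close>
  then consider "lex_by (<) L \<chi> \<psi>" | "lex_by (<) L \<psi> \<chi>"
    using lex_by_less_total[of L \<chi> \<psi>] assms(2) by auto
  then show ?thesis
  proof cases
    case 1
    then show ?thesis
      using \<chi> stab[OF \<chi>(1)] copies_e[OF \<chi>(1)] same_orbit[OF \<chi>(1) \<psi>(1)]
      by (intro exI[of _ \<chi>]) (auto simp: H_def)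
  next
    case 2
    then show ?thesis
      using \<psi> stab[OF \<psi>(1)] copies_e[OF \<psi>(1)] same_orbit[OF \<psi>(1) \<chi>(1)]
      by (intro exI[of _ \<psi>]) (auto simp: H_def)
  qed
qed

section \<open>Absence of finite SAGBI bases\<close>

text \<open>Read \<open>R x y\<close> as: exponent \<open>y\<close> wins over \<open>x\<close>. The
  exponents are \<open>a k\<close> at the first edge \<open>e\<close>, \<open>b k\<close> on the
  rest of the path and \<open>c k\<close> elsewhere. The winning \<open>a k\<close> protects
  \<open>e\<close>; by \<open>diff\<close> the increments at \<open>e\<close> and along the path
  agree, so quotients lose this protection.\<close>

lemma no_finite_sagbi_basis:
  fixes a b c :: "nat \<Rightarrow> nat" and R :: "nat \<Rightarrow> nat \<Rightarrow> bool"
  assumes "n \<ge> 4" and L: "set L = edges n"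
    and linear: "strict_linear_on {m. Poly_Mapping.keys m \<subseteq> edges n} mless"
    and mless: "\<And>s t. monom_deg s = monom_deg t \<Longrightarrow>
      mless s t \<longleftrightarrow> lex_by R L (Poly_Mapping.lookup s) (Poly_Mapping.lookup t)"
    and R: "asymp R"
    and abc: "\<And>k. R (c k) (b k)" "\<And>k. R (b k) (a k)" "\<And>k. R (c k) (a k)"
    and diff: "\<And>i j. i < j \<Longrightarrow> \<exists>u w. a j = a i + u \<and> b j = b i + u \<and> c j = c i + w \<and> R w u"
    and "finite (S :: 'k::field graph_poly set)"
  shows "\<not> sagbi_basis mless (graph_invariants n) S"
proof
  assume sagbi: "sagbi_basis mless (graph_invariants n) S"
  \<comment> \<open>Members of an orbit have equal degree, so \<open>lex_by\<close> decides between
    them.\<close>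
  have mless_act: "mless m (act_monom (inv \<tau>) m) \<longleftrightarrow>
      lex_by R L (Poly_Mapping.lookup m) (\<lambda>f. Poly_Mapping.lookup m (\<tau> ` f))"
    if "\<tau> permutes {1..n}" for m \<tau>
  proof -
    have "bij \<tau>" "bij (inv \<tau>)" using that by (simp_all add: permutes_bij bij_imp_bij_inv)
    then show ?thesis
      by (simp add: mless monom_deg_act_monom lookup_act_monom inv_inv_eq cong: lex_by_cong)
  qed
  have irrefl: "\<not> R x x" and asym: "R x y \<Longrightarrow> \<not> R y x" for x y
    using R by (auto simp: asymp_on_def)
  have neq: "b k \<noteq> c k" "c k \<noteq> b k" for k
    using abc(1)[of k] irrefl by metis+
  have "{1, 2} \<in> edges n" using assms(1) edges_memI[of 1 n 2] by simp
  then obtain e L' where eL: "L = e # L'" using L by (cases L) auto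
  then have e: "e \<in> edges n" using L by auto
  obtain \<chi> where \<chi>: "\<chi> e"
      "\<And>\<tau>. \<tau> permutes {1..n} \<Longrightarrow> \<tau> ` e = e \<Longrightarrow> \<not> lex_by (<) L \<chi> (\<lambda>f. \<chi> (\<tau> ` f))"
      "\<exists>\<tau>. \<tau> permutes {1..n} \<and> lex_by (<) L \<chi> (\<lambda>f. \<chi> (\<tau> ` f))"
    using ex_stabilizer_maximal_pattern[OF assms(1) L e] by blast
  define val where "val k f = (if f = e then a k else if \<chi> f then b k else c k)" for k f
  define m :: "nat \<Rightarrow> monom" where "m k = (\<Sum>f\<in>edges n. Poly_Mapping.single f (val k f))" for k
  have fin: "finite (edges n)" by (metis L finite_set)
  have lookup_m: "Poly_Mapping.lookup (m k) f = (if f \<in> edges n then val k f else 0)" for k f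
    using fin by (simp add: m_def lookup_sum lookup_single when_def)
  have "m k \<in> orbit_maximal n mless" for k
  proof -
    have "\<not> mless (m k) (act_monom \<sigma> (m k))" if \<sigma>: "\<sigma> permutes {1..n}" for \<sigma>
    proof -
      define \<tau> where "\<tau> = inv \<sigma>"
      have \<tau>: "\<tau> permutes {1..n}" "\<sigma> = inv \<tau>"
        using \<sigma> by (simp_all add: \<tau>_def permutes_inv inv_inv_eq permutes_bij)
      have inj: "\<tau> ` f = \<tau> ` g \<longleftrightarrow> f = g" for f g
        using \<tau>(1) by (simp add: inj_image_eq_iff permutes_inj)
      have "lex_by R L (Poly_Mapping.lookup (m k)) (\<lambda>f. Poly_Mapping.lookup (m k) (\<tau> ` f))
          \<longleftrightarrow> lex_by R L (val k) (\<lambda>f. val k (\<tau> ` f))"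
        using image_in_edges[OF \<tau>(1)] by (intro lex_by_cong) (simp_all add: lookup_m L)
      moreover have "\<not> lex_by R L (val k) (\<lambda>f. val k (\<tau> ` f))"
      proof (cases "\<tau> ` e = e")
        case True
        \<comment> \<open>The fixed edge \<open>e\<close> contributes a tie, and elsewhere
          \<open>b k\<close> and \<open>c k\<close> compare like \<open>True\<close> and
          \<open>False\<close>.\<close>
        have "lex_by R L (val k) (\<lambda>f. val k (\<tau> ` f)) \<longleftrightarrow> lex_by (<) L \<chi> (\<lambda>f. \<chi> (\<tau> ` f))"
        proof (rule lex_by_cong)
          fix f assume "f \<in> set L"
          have "R (val k f) (val k (\<tau> ` f)) = (\<chi> f < \<chi> (\<tau> ` f))
              \<and> (val k f = val k (\<tau> ` f)) = (\<chi> f = \<chi> (\<tau> ` f))"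
          proof (cases "f = e")
            case True
            then show ?thesis using \<open>\<tau> ` e = e\<close> irrefl by simp
          next
            case False
            moreover have "\<tau> ` f \<noteq> e" using inj[of f e] False \<open>\<tau> ` e = e\<close> by simp
            ultimately have v: "val k f = (if \<chi> f then b k else c k)"
                "val k (\<tau> ` f) = (if \<chi> (\<tau> ` f) then b k else c k)"
              by (simp_all add: val_def)
            show ?thesis unfolding v using neq abc(1) irrefl asym[OF abc(1)] by simp
          qed
          then show "R (val k f) (val k (\<tau> ` f)) = (\<chi> f < \<chi> (\<tau> ` f))"
            and "val k f = val k (\<tau> ` f) \<longleftrightarrow> \<chi> f = \<chi> (\<tau> ` f)"
            by blast+
        qed
        then show ?thesis using \<chi>(2)[OF \<tau>(1) True] by simp
      next
        case False
        \<comment> \<open>If \<open>\<tau>\<close> moves \<open>e\<close>, the very first comparison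
          decides in favour of \<open>m k\<close>.\<close>
        then have "R (val k (\<tau> ` e)) (val k e)" using abc by (simp add: val_def)
        then show ?thesis using asym irrefl by (auto simp: eL)
      qed
      ultimately show ?thesis using mless_act[OF \<tau>(1), of "m k"] by (simp add: \<tau>(2))
    qed
    moreover have "Poly_Mapping.keys (m k) \<subseteq> edges n"
      by (auto simp: in_keys_iff lookup_m split: if_splits)
    ultimately show ?thesis by (simp add: orbit_maximal_def)
  qed
  then obtain i j d where ij: "i < j" "m j = m i + d" and d: "d \<in> orbit_maximal n mless"
    using sagbi_basis_finite_imp_lead_exponent_difference[OF \<open>finite S\<close> sagbi, of m]
    by (auto simp: lead_exponents_graph_invariants[OF linear])
  obtain u w where uw: "a j = a i + u" "b j = b i + u" "c j = c i + w" "R w u"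
    using diff[OF ij(1)] by blast
  \<comment> \<open>As \<open>\<chi> e\<close> holds, \<open>e\<close> also receives
    \<open>u\<close>: the quotient has only two values and follows \<open>\<chi>\<close>.\<close>
  have lookup_d: "Poly_Mapping.lookup d f = (if \<chi> f then u else w)" if "f \<in> edges n" for f
  proof -
    have "val j f = val i f + Poly_Mapping.lookup d f"
      using arg_cong[OF ij(2), of "\<lambda>p. Poly_Mapping.lookup p f"] that
      by (simp add: lookup_add lookup_m)
    then show ?thesis using uw \<chi>(1) by (auto simp: val_def split: if_splits)
  qed
  obtain \<tau> where \<tau>: "\<tau> permutes {1..n}" "lex_by (<) L \<chi> (\<lambda>f. \<chi> (\<tau> ` f))"
    using \<chi>(3) by blast
  \<comment> \<open>Since \<open>R w u\<close>, the permutation that improves \<open>\<chi>\<close>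
    improves \<open>d\<close> as well.\<close>
  have "lex_by (<) L \<chi> (\<lambda>f. \<chi> (\<tau> ` f))
      \<longleftrightarrow> lex_by R L (Poly_Mapping.lookup d) (\<lambda>f. Poly_Mapping.lookup d (\<tau> ` f))"
    using image_in_edges[OF \<tau>(1)] uw(4) irrefl asym
    by (intro lex_by_cong) (auto simp: L lookup_d)
  then have "mless d (act_monom (inv \<tau>) d)" using \<tau>(2) mless_act[OF \<tau>(1), of d] by simp
  then show False using d permutes_inv[OF \<tau>(1)] by (simp add: orbit_maximal_def)
qed

theorem theorem2p2:
  fixes n :: nat
    and vs :: "nat set list"
    and mless :: "monom \<Rightarrow> monom \<Rightarrow> bool"
  assumes "n \<ge> 4"
    and "distinct vs" and "set vs = edges n"
    and "mless = lex_less vs \<or> mless = deglex_less vs \<or>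
      (mless = degrevlex_less vs \<and> pairwise adjacent (set (drop (length vs - (n - 1)) vs)))"
  shows "\<not> (\<exists>S :: 'k::field_char_0 graph_poly set.
    finite S \<and> sagbi_basis mless (graph_invariants n) S)"
proof -
  have lin: "strict_linear_on {m. Poly_Mapping.keys m \<subseteq> edges n} (lex_less vs)"
      "strict_linear_on {m. Poly_Mapping.keys m \<subseteq> edges n} (\<lambda>s t. lex_less (rev vs) t s)"
    using strict_linear_lex_less[of vs] strict_linear_on_flip[OF strict_linear_lex_less[of "rev vs"]]
    by (simp_all add: assms(3))
  \<comment> \<open>Agreement with \<open>lex_less\<close> in equal degrees suffices, so this serves
    \<open>lex_less\<close> and \<open>deglex_less\<close> alike.\<close>
  have lex: "\<not> sagbi_basis mless (graph_invariants n) S"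
    if S: "finite S" and linear: "strict_linear_on {m. Poly_Mapping.keys m \<subseteq> edges n} mless"
      and mless: "\<And>s t. monom_deg s = monom_deg t \<Longrightarrow> mless s t \<longleftrightarrow> lex_less vs s t"
    for S :: "'k graph_poly set" and mless
  \<comment> \<open>The path product has exponent \<open>k + 1\<close>, not \<open>k\<close>, so
    that \<open>c k < b k\<close> holds at \<open>k = 0\<close> too; the quotients are its
    powers.\<close>
  proof (rule no_finite_sagbi_basis[where R = "(<)" and a = "\<lambda>k. k + 2" and b = "\<lambda>k. k + 1"
        and c = "\<lambda>_. 0", OF assms(1,3) linear])
    show "mless s t \<longleftrightarrow> lex_by (<) vs (Poly_Mapping.lookup s) (Poly_Mapping.lookup t)"
      if "monom_deg s = monom_deg t" for s t
      using mless[OF that] by (simp only: lex_less_eq_lex_by)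
    show "\<exists>u w. j + 2 = i + 2 + u \<and> j + 1 = i + 1 + u \<and> 0 = 0 + w \<and> w < u"
      if "i < j" for i j :: nat
      using that by (intro exI[of _ "j - i"] exI[of _ 0]) simp
  qed (use S in \<open>simp_all add: asymp_on_def\<close>)
  show ?thesis
  proof safe
    fix S :: "'k graph_poly set"
    assume S: "finite S" "sagbi_basis mless (graph_invariants n) S"
    consider "mless = lex_less vs" | "mless = deglex_less vs" | "mless = degrevlex_less vs"
      using assms(4) by blast
    then show False
    proof cases
      case 1
      then show False using lex[OF S(1)] lin(1) S(2) by blast
    next
      case 2
      have "strict_linear_on {m. Poly_Mapping.keys m \<subseteq> edges n} (deglex_less vs)"
        using strict_linear_on_refine[OF lin(1), of monom_deg] by (simp add: deglex_less_def[abs_def])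
      then show False
        using lex[OF S(1), of "deglex_less vs"] S(2) 2 by (simp add: deglex_less_def)
    next
      case 3
      have lin': "strict_linear_on {m. Poly_Mapping.keys m \<subseteq> edges n} (degrevlex_less vs)"
        using strict_linear_on_refine[OF lin(2), of monom_deg]
        by (simp add: degrevlex_less_def[abs_def])
      have "\<not> sagbi_basis (degrevlex_less vs) (graph_invariants n) S"
      \<comment> \<open>The smallest variable is compared first and the smaller exponent wins. The
        exponents 0, 1, \<open>k + 2\<close> are \<open>k + 2\<close> minus the former
        \<open>k + 2\<close>, \<open>k + 1\<close>, 0, and the quotients are powers of the product
        over the edges off the path.\<close>
      proof (rule no_finite_sagbi_basis[where R = "\<lambda>x y. y < x" and L = "rev vs" and a = "\<lambda>_. 0"
            and b = "\<lambda>_. 1" and c = "\<lambda>k. k + 2", OF assms(1) _ lin'])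
        show "set (rev vs) = edges n" using assms(3) by simp
        show "degrevlex_less vs s t
            \<longleftrightarrow> lex_by (\<lambda>x y. y < x) (rev vs) (Poly_Mapping.lookup s) (Poly_Mapping.lookup t)"
          if "monom_deg s = monom_deg t" for s t
          unfolding degrevlex_less_def lex_less_eq_lex_by lex_by_flip[of "(<)"] using that by simp
        show "\<exists>u w. 0 = 0 + u \<and> 1 = 1 + u \<and> j + 2 = i + 2 + w \<and> u < w"
          if "i < j" for i j :: nat
          using that by (intro exI[of _ 0] exI[of _ "j - i"]) simp
      qed (use S in \<open>simp_all add: asymp_on_def\<close>)
      then show False using S(2) 3 by blast
    qed
  qed
qed

end
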